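(* Let $k\geq 1$ be an integer and let $D$ be a $k$-degenerate directed graph. Then $f(D)\leq \frac{k-1}{k+1}\,n(D)$.
   Context: Directed graphs are oriented graphs: finite, no loops, no multiple arcs and no pair of antiparallel arcs. $n(D)$ is the number of vertices and $f(D)$ is the minimum size of a set $F\subseteq V(D)$ such that $D-F$ contains no directed cycle. A directed graph is $k$-degenerate if its underlying undirected graph is $k$-degenerate, i.e. has an ordering of the vertices in which every vertex has at most $k$ neighbours preceding it. *)

theory Defs
  imports Complex_Main
begin

definition oriented_graph :: "'a set \<Rightarrow> ('a \<times> 'a) set \<Rightarrow> bool" where
  "oriented_graph V A \<longleftrightarrow> finite V \<and> A \<subseteq> V \<times> V \<and>
     (\<forall>u v. (u, v) \<in> A \<longrightarrow> u \<noteq> v \<and> (v, u) \<notin> A)"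

definition del_vertices :: "'a set \<Rightarrow> ('a \<times> 'a) set \<Rightarrow> 'a set \<Rightarrow> ('a \<times> 'a) set" where
  "del_vertices V A F = A \<inter> ((V - F) \<times> (V - F))"

definition fvs_number :: "'a set \<Rightarrow> ('a \<times> 'a) set \<Rightarrow> nat" where
  "fvs_number V A = Min {card F | F. F \<subseteq> V \<and> acyclic (del_vertices V A F)}"

definition adjacent :: "('a \<times> 'a) set \<Rightarrow> 'a \<Rightarrow> 'a \<Rightarrow> bool" where
  "adjacent A u v \<longleftrightarrow> (u, v) \<in> A \<or> (v, u) \<in> A"

definition degenerate :: "nat \<Rightarrow> 'a set \<Rightarrow> ('a \<times> 'a) set \<Rightarrow> bool" where
  "degenerate k V A \<longleftrightarrow> (\<exists>xs. distinct xs \<and> set xs = V \<and>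
     (\<forall>i < length xs. card {j. j < i \<and> adjacent A (xs ! i) (xs ! j)} \<le> k))"

end

theory Submission
  imports Defs
begin

text \<open>
  It suffices to find an acyclic set of at least \<open>2n/(k+1)\<close> vertices. This goes by
  induction: delete a set \<open>T\<close> containing a nonempty \<open>G\<close> with \<open>2|T| \<le> (k+1)|G|\<close> such
  that every acyclic set avoiding \<open>T\<close> remains acyclic after adding \<open>G\<close>. A vertex can be
  added as a source or as a sink once its in-neighbours or its out-neighbours are deleted.

  Degeneracy yields an isolated vertex or a vertex \<open>u\<close> with a nonempty independent set \<open>L\<close> of
  neighbours of degree at most \<open>k\<close> such that \<open>u\<close> has at most \<open>k\<close> neighbours outside \<open>L\<close>. If
  two vertices \<open>u, v\<close> of degree at most \<open>k\<close> are adjacent, take \<open>L = {v}\<close>. Otherwise remove all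
  vertices of degree at most \<open>k\<close>; if anything remains, it contains a vertex \<open>u\<close> of remaining
  degree at most \<open>k\<close>, and \<open>L\<close> consists of the removed neighbours of \<open>u\<close>.

  If \<open>v \<in> L\<close> has at most \<open>(k-1)/2\<close> in-neighbours or out-neighbours, delete these and take
  \<open>G = {v}\<close>. Otherwise \<open>v\<close> has exactly \<open>k/2\<close> neighbours of each kind. If \<open>L\<close> contains a second
  such vertex \<open>w\<close>, then \<open>G = {v, w}\<close> works because the sides of \<open>v\<close> and \<open>w\<close> containing \<open>u\<close> overlap.
  If \<open>L = {v}\<close>, then \<open>u\<close> has degree at most \<open>k + 1\<close>, hence a side of at most \<open>k/2\<close>
  vertices, and \<open>G = {u, v}\<close> works.
\<close>

section \<open>Neighbourhoods and degeneracy\<close>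

definition neighbours :: "('a \<times> 'a) set \<Rightarrow> 'a set \<Rightarrow> 'a \<Rightarrow> 'a set" where
  "neighbours A W x = {y \<in> W. adjacent A x y}"

definition sides :: "('a \<times> 'a) set \<Rightarrow> 'a set \<Rightarrow> 'a \<Rightarrow> 'a set set" where
  "sides A W x = {A\<inverse> `` {x} \<inter> W, A `` {x} \<inter> W}"

definition subset_degenerate :: "nat \<Rightarrow> ('a \<times> 'a) set \<Rightarrow> 'a set \<Rightarrow> bool" where
  "subset_degenerate k A W \<longleftrightarrow> (\<forall>U \<subseteq> W. U \<noteq> {} \<longrightarrow> (\<exists>x \<in> U. card (neighbours A U x) \<le> k))"

lemma adjacent_commute: "adjacent A x y \<longleftrightarrow> adjacent A y x"
  by (auto simp: adjacent_def)

lemma not_adjacent_self: "irrefl A \<Longrightarrow> \<not> adjacent A x x"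
  by (simp add: adjacent_def irrefl_def)

lemma side_subset_neighbours: "X \<in> sides A W x \<Longrightarrow> X \<subseteq> neighbours A W x"
  by (auto simp: sides_def neighbours_def adjacent_def)

lemma finite_side: "finite W \<Longrightarrow> X \<in> sides A W x \<Longrightarrow> finite X"
  by (auto simp: sides_def)

lemma card_in_plus_card_out:
  assumes "finite W" and "asym A"
  shows "card (A\<inverse> `` {x} \<inter> W) + card (A `` {x} \<inter> W) = card (neighbours A W x)"
proof -
  have "A\<inverse> `` {x} \<inter> A `` {x} = {}"
    using asymD[OF assms(2)] by blast
  moreover have "neighbours A W x = (A\<inverse> `` {x} \<inter> W) \<union> (A `` {x} \<inter> W)"
    by (auto simp: neighbours_def adjacent_def)
  ultimately show ?thesis
    using assms(1) by (subst card_Un_disjoint[symmetric]) auto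
qed

lemma neighbour_in_one_side:
  assumes "finite W" and "asym A" and "u \<in> neighbours A W v"
  obtains X Y where "X \<in> sides A W v" and "u \<in> X" and "Y \<in> sides A W v" and "u \<notin> Y"
    and "card X + card Y = card (neighbours A W v)"
proof -
  let ?I = "A\<inverse> `` {v} \<inter> W" and ?O = "A `` {v} \<inter> W"
  have in_sides: "?I \<in> sides A W v" "?O \<in> sides A W v"
    by (simp_all add: sides_def)
  have "card ?I + card ?O = card (neighbours A W v)"
    using assms(1,2) by (rule card_in_plus_card_out)
  moreover have "u \<in> ?I \<and> u \<notin> ?O \<or> u \<in> ?O \<and> u \<notin> ?I"
    using assms(3) asymD[OF assms(2)] by (auto simp: neighbours_def adjacent_def)
  ultimately show thesis
    using that[of ?I ?O] that[of ?O ?I] in_sides by linarith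
qed

lemma subset_degenerate_mono:
  "subset_degenerate k A W \<Longrightarrow> U \<subseteq> W \<Longrightarrow> subset_degenerate k A U"
  unfolding subset_degenerate_def using order_trans[of _ U W] by simp

lemma degenerate_imp_subset_degenerate:
  assumes "irrefl A" and "degenerate k V A"
  shows "subset_degenerate k A V"
  unfolding subset_degenerate_def
proof (intro allI impI)
  fix U assume "U \<subseteq> V" and "U \<noteq> {}"
  obtain xs where "set xs = V"
    and back_degree: "\<And>i. i < length xs \<Longrightarrow> card {j. j < i \<and> adjacent A (xs ! i) (xs ! j)} \<le> k"
    using assms(2) unfolding degenerate_def by blast
  then have "\<exists>x \<in> set xs. x \<in> U"
    using \<open>U \<subseteq> V\<close> \<open>U \<noteq> {}\<close> by blast
  then obtain ys x zs where xs: "xs = ys @ x # zs" and "x \<in> U" and "\<forall>z \<in> set zs. z \<notin> U"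
    by (rule split_list_last_propE)
  let ?B = "{j. j < length ys \<and> adjacent A (xs ! length ys) (xs ! j)}"
  have "neighbours A U x \<subseteq> (!) xs ` ?B"
  proof
    fix y assume "y \<in> neighbours A U x"
    then have "y \<in> U" and "adjacent A x y"
      by (simp_all add: neighbours_def)
    then have "y \<noteq> x"
      using not_adjacent_self[OF assms(1)] by blast
    then have "y \<in> set ys"
      using \<open>y \<in> U\<close> \<open>U \<subseteq> V\<close> \<open>set xs = V\<close> \<open>\<forall>z \<in> set zs. z \<notin> U\<close> xs by auto
    then obtain j where "j < length ys" and "y = ys ! j"
      unfolding in_set_conv_nth by blast
    then show "y \<in> (!) xs ` ?B"
      using \<open>adjacent A x y\<close> by (intro image_eqI[of _ _ j]) (simp_all add: xs nth_append)
  qed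
  then have "card (neighbours A U x) \<le> card ?B"
    by (rule surj_card_le[rotated]) simp
  also have "\<dots> \<le> k"
    by (rule back_degree) (simp add: xs)
  finally show "\<exists>x \<in> U. card (neighbours A U x) \<le> k"
    using \<open>x \<in> U\<close> by blast
qed

lemma subset_degenerate_cases:
  assumes "irrefl A" and "subset_degenerate k A W" and "W \<noteq> {}"
  obtains (isolated) x where "x \<in> W" and "neighbours A W x = {}"
  | (fan) u L where "u \<in> W" and "L \<subseteq> neighbours A W u" and "L \<noteq> {}"
      and "card (neighbours A W u - L) \<le> k"
      and "\<And>v. v \<in> L \<Longrightarrow> card (neighbours A W v) \<le> k"
      and "\<And>v w. v \<in> L \<Longrightarrow> w \<in> L \<Longrightarrow> \<not> adjacent A v w"
proof -
  define M where "M = {x \<in> W. card (neighbours A W x) \<le> k}"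
  show thesis
  proof (cases "\<exists>u \<in> M. \<exists>v \<in> M. adjacent A u v")
    case True
    then obtain u v where "u \<in> M" and "v \<in> M" and "adjacent A u v"
      by blast
    then show thesis
      using not_adjacent_self[OF assms(1)] card_Diff1_le[of "neighbours A W u" v]
      by (intro fan[of u "{v}"]) (auto simp: M_def neighbours_def intro: order_trans)
  next
    case M_independent: False
    show thesis
    proof (cases "W \<subseteq> M")
      case True
      obtain x where "x \<in> W"
        using assms(3) by blast
      moreover have "neighbours A W x = {}"
        using M_independent True \<open>x \<in> W\<close> by (auto simp: neighbours_def)
      ultimately show thesis
        by (rule isolated)
    next
      case False
      then obtain u where u: "u \<in> W - M" "card (neighbours A (W - M) u) \<le> k"
        using assms(2)[unfolded subset_degenerate_def, rule_format, of "W - M"] by auto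
      let ?L = "neighbours A W u \<inter> M"
      have outside_L: "neighbours A W u - ?L = neighbours A (W - M) u"
        by (auto simp: neighbours_def)
      show thesis
      proof (rule fan[of u ?L])
        show "?L \<noteq> {}"
          using u outside_L by (force simp: M_def)
      qed (use u outside_L M_independent in \<open>auto simp: M_def\<close>)
    qed
  qed
qed

section \<open>Extending acyclic sets\<close>

lemma acyclic_Restr_insert_source:
  assumes "acyclic (Restr A S)" and source: "\<And>y. y \<in> insert x S \<Longrightarrow> (y, x) \<notin> A"
  shows "acyclic (Restr A (insert x S))"
proof -
  let ?R = "Restr A (insert x S)"
  have "(a, b) \<in> (Restr A S)\<^sup>+" if "(a, b) \<in> ?R\<^sup>+" and "a \<noteq> x" for a b
    using that(1)
  proof (induction rule: trancl_induct)
    case (base b)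
    then have "(a, b) \<in> Restr A S"
      using that(2) source by auto
    then show ?case ..
  next
    case (step b c)
    have "b \<in> S"
      using step.IH by (auto dest: tranclD2)
    then have "(b, c) \<in> Restr A S"
      using step.hyps(2) source by auto
    with step.IH show ?case ..
  qed
  moreover have "(x, x) \<notin> ?R\<^sup>+"
    using source by (auto dest: tranclD2)
  ultimately show ?thesis
    using assms(1) by (auto simp: acyclic_def)
qed

lemma acyclic_Restr_converse: "acyclic (Restr (A\<inverse>) S) \<longleftrightarrow> acyclic (Restr A S)"
proof -
  have "Restr (A\<inverse>) S = (Restr A S)\<inverse>"
    by auto
  then show ?thesis
    by (simp only: acyclic_converse)
qed

lemma acyclic_Restr_insert_sink:
  assumes "acyclic (Restr A S)" and "\<And>y. y \<in> insert x S \<Longrightarrow> (x, y) \<notin> A"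
  shows "acyclic (Restr A (insert x S))"
proof -
  have "acyclic (Restr (A\<inverse>) (insert x S))"
    using assms by (intro acyclic_Restr_insert_source) (auto simp: acyclic_Restr_converse)
  then show ?thesis
    unfolding acyclic_Restr_converse .
qed

lemma acyclic_Restr_insert:
  assumes "acyclic (Restr A S)" and "S \<subseteq> W" and "(x, x) \<notin> A"
    and "X \<in> sides A W x" and "X \<inter> S = {}"
  shows "acyclic (Restr A (insert x S))"
proof -
  consider (in_side) "X = A\<inverse> `` {x} \<inter> W" | (out_side) "X = A `` {x} \<inter> W"
    using assms(4) by (auto simp: sides_def)
  then show ?thesis
  proof cases
    case in_side
    then show ?thesis
      using assms by (intro acyclic_Restr_insert_source) auto
  next
    case out_side
    then show ?thesis
      using assms by (intro acyclic_Restr_insert_sink) auto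
  qed
qed

definition restorable :: "('a \<times> 'a) set \<Rightarrow> 'a set \<Rightarrow> 'a set \<Rightarrow> 'a set \<Rightarrow> bool" where
  "restorable A W T G \<longleftrightarrow> G \<subseteq> T \<and> T \<subseteq> W \<and>
     (\<forall>S \<subseteq> W - T. acyclic (Restr A S) \<longrightarrow> acyclic (Restr A (S \<union> G)))"

lemma restorable_empty: "restorable A W {} {}"
  by (simp add: restorable_def)

lemma restorable_insert:
  assumes "restorable A W T G" and "x \<in> W" and "(x, x) \<notin> A"
    and "X \<in> sides A W x" and "X \<inter> G = {}"
  shows "restorable A W (T \<union> insert x X) (insert x G)"
  unfolding restorable_def
proof (intro conjI allI impI)
  have "G \<subseteq> T" and "T \<subseteq> W"
    and restore: "\<And>S. S \<subseteq> W - T \<Longrightarrow> acyclic (Restr A S) \<Longrightarrow> acyclic (Restr A (S \<union> G))"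
    using assms(1) by (simp_all add: restorable_def)
  show "insert x G \<subseteq> T \<union> insert x X"
    using \<open>G \<subseteq> T\<close> by blast
  show "T \<union> insert x X \<subseteq> W"
    using \<open>T \<subseteq> W\<close> assms(2,4) by (auto simp: sides_def)
  fix S assume S: "S \<subseteq> W - (T \<union> insert x X)" and "acyclic (Restr A S)"
  then have "acyclic (Restr A (S \<union> G))"
    by (intro restore) auto
  moreover have "S \<union> G \<subseteq> W" and "X \<inter> (S \<union> G) = {}"
    using S \<open>G \<subseteq> T\<close> \<open>T \<subseteq> W\<close> assms(5) by auto
  ultimately have "acyclic (Restr A (insert x (S \<union> G)))"
    using acyclic_Restr_insert assms(3,4) by metis
  then show "acyclic (Restr A (S \<union> insert x G))"
    by simp
qed

section \<open>Reducible configurations\<close>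

definition reducible :: "nat \<Rightarrow> ('a \<times> 'a) set \<Rightarrow> 'a set \<Rightarrow> bool" where
  "reducible k A W \<longleftrightarrow>
     (\<exists>T G. restorable A W T G \<and> G \<noteq> {} \<and> 2 * card T \<le> (k + 1) * card G)"

lemma reducible_small_side:
  assumes "x \<in> W" and "(x, x) \<notin> A" and "X \<in> sides A W x" and "2 * card X < k"
  shows "reducible k A W"
proof -
  have "restorable A W (insert x X) {x}"
    using restorable_insert[OF restorable_empty assms(1-3)] by simp
  moreover have "2 * card (insert x X) \<le> (k + 1) * card {x}"
    using card_insert_le_m1[of "Suc (card X)" X x] assms(4) by simp
  ultimately show ?thesis
    unfolding reducible_def by blast
qed

text \<open>Only \<open>x \<notin> Y\<close> is required, as \<open>x\<close> is restored before \<open>y\<close>; the set \<open>X\<close> may contain \<open>y\<close>.\<close>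

lemma reducible_pair:
  assumes "irrefl A" and "x \<in> W" and "y \<in> W" and "x \<noteq> y"
    and "X \<in> sides A W x" and "Y \<in> sides A W y" and "x \<notin> Y"
    and "card (insert x X \<union> insert y Y) \<le> k + 1"
  shows "reducible k A W"
proof -
  have "restorable A W (insert x X) {x}"
    using restorable_insert[OF restorable_empty, of x W A X] assms(1,2,5)
    by (simp add: irrefl_def)
  then have "restorable A W (insert x X \<union> insert y Y) {y, x}"
    using assms(1,3,6,7) by (intro restorable_insert) (simp_all add: irrefl_def)
  moreover have "2 * card (insert x X \<union> insert y Y) \<le> (k + 1) * card {y, x}"
    using assms(4,8) by simp
  ultimately show ?thesis
    unfolding reducible_def by blast
qed

lemma reducible_adjacent_pair:
  assumes "irrefl A" and "x \<in> W" and "y \<in> W"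
    and "X \<in> sides A W x" and "y \<in> X" and "Y \<in> sides A W y" and "x \<notin> Y"
    and "card X + card Y \<le> k"
  shows "reducible k A W"
proof (rule reducible_pair[OF assms(1-3) _ assms(4,6,7)])
  show "x \<noteq> y"
    using assms(1,4,5) by (auto simp: sides_def irrefl_def)
  have "card (insert x X \<union> insert y Y) = card (insert x (X \<union> Y))"
    using assms(5) by (simp add: insert_absorb)
  also have "\<dots> \<le> Suc (card (X \<union> Y))"
    by (rule card_insert_le_m1) simp_all
  also have "\<dots> \<le> k + 1"
    using card_Un_le[of X Y] assms(8) by simp
  finally show "card (insert x X \<union> insert y Y) \<le> k + 1" .
qed

lemma card_side_if_irreducible:
  assumes "finite W" and "asym A" and "v \<in> W" and "card (neighbours A W v) \<le> k"
    and "\<not> reducible k A W" and "X \<in> sides A W v"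
  shows "2 * card X = k"
proof -
  let ?I = "A\<inverse> `` {v} \<inter> W" and ?O = "A `` {v} \<inter> W"
  have "(v, v) \<notin> A"
    using asymD[OF assms(2)] by blast
  then have "k \<le> 2 * card Y" if "Y \<in> sides A W v" for Y
    using reducible_small_side[OF assms(3) _ that] assms(5) linorder_not_le by blast
  then have "k \<le> 2 * card ?I" and "k \<le> 2 * card ?O"
    by (simp_all add: sides_def)
  moreover have "card ?I + card ?O = card (neighbours A W v)"
    using assms(1,2) by (rule card_in_plus_card_out)
  ultimately have "2 * card ?I = k" and "2 * card ?O = k"
    using assms(4) by linarith+
  then show ?thesis
    using assms(6) by (auto simp: sides_def)
qed

lemma reducible_common_neighbour:
  assumes "finite W" and "asym A" and "v \<in> W" and "w \<in> W" and "v \<noteq> w" and "\<not> adjacent A v w"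
    and "u \<in> neighbours A W v" and "u \<in> neighbours A W w"
    and "card (neighbours A W v) \<le> k" and "card (neighbours A W w) \<le> k"
  shows "reducible k A W"
proof (rule ccontr)
  assume irreducible: "\<not> reducible k A W"
  obtain X where X: "X \<in> sides A W v" "u \<in> X"
    using assms(1,2,7) by (rule neighbour_in_one_side)
  obtain Y where Y: "Y \<in> sides A W w" "u \<in> Y"
    using assms(1,2,8) by (rule neighbour_in_one_side)
  have fin: "finite X" "finite Y"
    using X Y finite_side[OF assms(1)] by blast+
  have "2 * card X = k" and "2 * card Y = k"
    using card_side_if_irreducible[OF assms(1,2) _ _ irreducible] assms(3,4,9,10) X Y by blast+
  moreover have "card (X \<inter> Y) > 0"
    using X Y fin by (auto simp: card_gt_0_iff)
  ultimately have "card (X \<union> Y) + 1 \<le> k"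
    using card_Un_Int[OF fin] by linarith
  then have "card (insert v X \<union> insert w Y) \<le> k + 1"
    using fin by (simp add: card_insert_if)
  moreover have "v \<notin> Y"
    using side_subset_neighbours[OF Y(1)] assms(6) by (auto simp: neighbours_def adjacent_commute)
  moreover have "irrefl A"
    using assms(2) by (rule irrefl_on_if_asym_on)
  ultimately show False
    using reducible_pair[OF _ assms(3-5) X(1) Y(1)] irreducible by blast
qed

lemma reducible_adjacent:
  assumes "finite W" and "asym A" and "u \<in> W" and "v \<in> neighbours A W u"
    and "card (neighbours A W v) \<le> k" and "card (neighbours A W u) \<le> k + 1"
  shows "reducible k A W"
proof (rule ccontr)
  assume irreducible: "\<not> reducible k A W"
  have irrefl: "irrefl A"
    using assms(2) by (rule irrefl_on_if_asym_on)
  have "v \<in> W" and "u \<in> neighbours A W v"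
    using assms(3,4) by (simp_all add: neighbours_def adjacent_commute)
  obtain X X' where X: "X \<in> sides A W v" "u \<in> X" and X': "X' \<in> sides A W v" "u \<notin> X'"
    using assms(1,2) \<open>u \<in> neighbours A W v\<close> by (rule neighbour_in_one_side)
  obtain Y Y' where Y: "Y \<in> sides A W u" "v \<in> Y" and Y': "Y' \<in> sides A W u" "v \<notin> Y'"
    and "card Y + card Y' = card (neighbours A W u)"
    using assms(1,2,4) by (rule neighbour_in_one_side)
  then have "card Y + card Y' \<le> k + 1"
    using assms(6) by simp
  moreover have "2 * card X = k" and "2 * card X' = k"
    using card_side_if_irreducible[OF assms(1,2) \<open>v \<in> W\<close> assms(5) irreducible] X X' by blast+
  ultimately consider (v_first) "card X + card Y' \<le> k" | (u_first) "card Y + card X' \<le> k"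
    by linarith
  then show False
  proof cases
    case v_first
    then show False
      using reducible_adjacent_pair[OF irrefl \<open>v \<in> W\<close> assms(3) X Y'] irreducible by blast
  next
    case u_first
    then show False
      using reducible_adjacent_pair[OF irrefl assms(3) \<open>v \<in> W\<close> Y X'] irreducible by blast
  qed
qed

lemma reducible_if_subset_degenerate:
  assumes "finite W" and "W \<noteq> {}" and "k \<ge> 1" and "asym A" and "subset_degenerate k A W"
  shows "reducible k A W"
proof -
  have irrefl: "irrefl A"
    using assms(4) by (rule irrefl_on_if_asym_on)
  from irrefl assms(5,2) show ?thesis
  proof (cases rule: subset_degenerate_cases)
    case (isolated x)
    then have "A `` {x} \<inter> W = {}"
      by (auto simp: neighbours_def adjacent_def)
    moreover have "A `` {x} \<inter> W \<in> sides A W x"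
      by (simp add: sides_def)
    ultimately show ?thesis
      using reducible_small_side[OF isolated(1) irreflD[OF irrefl], of "{}" k] assms(3) by simp
  next
    case (fan u L)
    from \<open>L \<noteq> {}\<close> obtain v where "v \<in> L"
      by blast
    show ?thesis
    proof (cases "L = {v}")
      case True
      then have "card (neighbours A W u) \<le> k + 1"
        using fan(4) card_Diff1_le[of "neighbours A W u" v]
        by (simp add: card_Diff_singleton_if split: if_splits)
      then show ?thesis
        using fan(2,5) \<open>v \<in> L\<close> by (intro reducible_adjacent[OF assms(1,4) fan(1)]) auto
    next
      case False
      then obtain w where "w \<in> L" and "v \<noteq> w"
        using \<open>v \<in> L\<close> by blast
      have common: "x \<in> W" "u \<in> neighbours A W x" if "x \<in> L" for x
        using fan(1,2) that by (auto simp: neighbours_def adjacent_commute)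
      show ?thesis
        by (rule reducible_common_neighbour[OF assms(1,4), of v w u])
          (fact | rule common fan(5,6))+
    qed
  qed
qed

section \<open>Large acyclic sets and feedback vertex sets\<close>

lemma large_acyclic_set:
  assumes "finite W" and "k \<ge> 1" and "asym A" and "subset_degenerate k A W"
  shows "\<exists>S \<subseteq> W. acyclic (Restr A S) \<and> 2 * card W \<le> (k + 1) * card S"
  using assms(1,4)
proof (induction W rule: finite_psubset_induct)
  case (psubset W)
  show ?case
  proof (cases "W = {}")
    case True
    then show ?thesis
      by (auto simp: acyclic_def)
  next
    case False
    then obtain T G where "restorable A W T G" and "G \<noteq> {}"
      and T_small: "2 * card T \<le> (k + 1) * card G"
      using reducible_if_subset_degenerate[OF psubset.hyps _ assms(2,3) psubset.prems]
      unfolding reducible_def by blast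
    then have "G \<subseteq> T" and "T \<subseteq> W"
      and restore: "\<And>S. S \<subseteq> W - T \<Longrightarrow> acyclic (Restr A S) \<Longrightarrow> acyclic (Restr A (S \<union> G))"
      by (simp_all add: restorable_def)
    have "W - T \<subset> W"
      using \<open>G \<noteq> {}\<close> \<open>G \<subseteq> T\<close> \<open>T \<subseteq> W\<close> by blast
    then obtain S where S: "S \<subseteq> W - T" "acyclic (Restr A S)"
      and S_large: "2 * card (W - T) \<le> (k + 1) * card S"
      using psubset.IH subset_degenerate_mono[OF psubset.prems] by (metis Diff_subset)
    have fin: "finite T" "finite G" "finite S"
      using \<open>G \<subseteq> T\<close> \<open>T \<subseteq> W\<close> S(1) psubset.hyps by (meson finite_subset Diff_subset)+
    have "card W = card (W - T) + card T"
      using \<open>T \<subseteq> W\<close> fin(1) psubset.hyps by (simp add: card_Diff_subset card_mono)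
    moreover have "card (S \<union> G) = card S + card G"
      using S(1) \<open>G \<subseteq> T\<close> fin by (intro card_Un_disjoint) auto
    ultimately have "2 * card W \<le> (k + 1) * card (S \<union> G)"
      using S_large T_small by (simp add: algebra_simps)
    moreover have "S \<union> G \<subseteq> W"
      using S(1) \<open>G \<subseteq> T\<close> \<open>T \<subseteq> W\<close> by blast
    ultimately show ?thesis
      using restore[OF S] by blast
  qed
qed

lemma fvs_number_le_if_acyclic:
  assumes "finite V" and "S \<subseteq> V" and "acyclic (Restr A S)"
  shows "fvs_number V A \<le> card V - card S"
proof -
  have "V - (V - S) = S"
    using assms(2) by blast
  then have "acyclic (del_vertices V A (V - S))"
    using assms(3) by (simp add: del_vertices_def)
  then have "fvs_number V A \<le> card (V - S)"
    unfolding fvs_number_def using assms(1) by (intro Min_le) auto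
  also have "\<dots> = card V - card S"
    using assms(1,2) by (simp add: card_Diff_subset finite_subset)
  finally show ?thesis .
qed

theorem mainTheorem5:
  fixes V :: "'a set" and A :: "('a \<times> 'a) set" and k :: nat
  assumes "k \<ge> 1"
    and "oriented_graph V A"
    and "degenerate k V A"
  shows "real (fvs_number V A) \<le> (real k - 1) / (real k + 1) * real (card V)"
proof -
  have "finite V" and "asym A"
    using assms(2) by (auto simp: oriented_graph_def)
  have "subset_degenerate k A V"
    using irrefl_on_if_asym_on[OF \<open>asym A\<close>] assms(3) by (rule degenerate_imp_subset_degenerate)
  then obtain S where S: "S \<subseteq> V" "acyclic (Restr A S)"
    and S_large: "2 * card V \<le> (k + 1) * card S"
    using large_acyclic_set[OF \<open>finite V\<close> assms(1) \<open>asym A\<close>] by blast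
  have "2 * real (card V) \<le> (real k + 1) * real (card S)"
    using of_nat_mono[OF S_large, where 'a = real] by (simp add: algebra_simps)
  then have "2 / (real k + 1) * real (card V) \<le> real (card S)"
    by (simp add: field_simps)
  moreover have "real (fvs_number V A) \<le> real (card V) - real (card S)"
    using fvs_number_le_if_acyclic[OF \<open>finite V\<close> S] card_mono[OF \<open>finite V\<close> S(1)] by linarith
  moreover have "(real k - 1) / (real k + 1) = 1 - 2 / (real k + 1)"
    by (simp add: field_simps)
  ultimately show ?thesis
    by (simp add: left_diff_distrib)
qed

end
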